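(* Every admissible BiHom-Poisson algebra $(A,\mu,\alpha,\beta)$ is BiHom-flexible, i.e. $$as_A(\beta^2(x),\alpha\beta(y),\alpha^2(z))+as_A(\beta^2(z),\alpha\beta(y),\alpha^2(x))=0$$ for all $x,y,z\in A$.
   Context: All vector spaces are over an algebraically closed field $\mathbb{K}$ of characteristic $0$. A BiHom-algebra is a quadruple $(A,\mu,\alpha,\beta)$ with $A$ a vector space, $\mu:A\otimes A\to A$ linear and $\alpha,\beta:A\to A$ linear with $\alpha\beta=\beta\alpha$. Its BiHom-associator is $as_A(x,y,z)=\mu(\mu(x,y),\beta(z))-\mu(\alpha(x),\mu(y,z))$. A BiHom-algebra is called BiHom-flexible if $as_A(\beta^2(x),\alpha\beta(y),\alpha^2(x))=0$ for all $x,y\in A$; equivalently (by linearization), the displayed identity of the claim holds for all $x,y,z$. A BiHom-algebra $(A,\mu,\alpha,\beta)$ is called an admissible BiHom-Poisson algebra if for all $x,y,z\in A$ $$as_A(\beta(x),\alpha(y),\alpha^2(z))=\tfrac13\Big\{\mu(\mu(\beta(x),\alpha\beta(z)),\alpha^2(y))-\mu(\mu(\beta^2(z),\alpha(x)),\alpha^2(y))+\mu(\mu(\beta(y),\alpha\beta(z)),\alpha^2(x))-\mu(\mu(\beta(y),\alpha(x)),\beta\alpha^2(z))\Big\}.$$ *)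

theory Defs
  imports "HOL-Computational_Algebra.Polynomial"
begin

text \<open>
  The multiplication, a linear map on \<open>A \<otimes> A\<close>, is rendered as a curried bilinear map.
  The structure maps \<open>\<alpha>\<close>, \<open>\<beta>\<close> are not assumed to be multiplicative.
\<close>

locale bihom_algebra = vector_space scale
  for scale :: "'k::{alg_closed_field, field_char_0} \<Rightarrow> 'a::ab_group_add \<Rightarrow> 'a" +
  fixes \<mu> :: "'a \<Rightarrow> 'a \<Rightarrow> 'a"
    and \<alpha> \<beta> :: "'a \<Rightarrow> 'a"
  assumes linear_mult_right: "\<And>x. Vector_Spaces.linear scale scale (\<lambda>y. \<mu> x y)"
    and linear_mult_left: "\<And>y. Vector_Spaces.linear scale scale (\<lambda>x. \<mu> x y)"
    and linear_alpha: "Vector_Spaces.linear scale scale \<alpha>"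
    and linear_beta: "Vector_Spaces.linear scale scale \<beta>"
    and alpha_beta_commute: "\<alpha> \<circ> \<beta> = \<beta> \<circ> \<alpha>"

definition bihom_associator ::
  "('a \<Rightarrow> 'a \<Rightarrow> 'a::ab_group_add) \<Rightarrow> ('a \<Rightarrow> 'a) \<Rightarrow> ('a \<Rightarrow> 'a) \<Rightarrow> 'a \<Rightarrow> 'a \<Rightarrow> 'a \<Rightarrow> 'a" where
  "bihom_associator \<mu> \<alpha> \<beta> x y z = \<mu> (\<mu> x y) (\<beta> z) - \<mu> (\<alpha> x) (\<mu> y z)"

locale bihom_flexible_algebra = bihom_algebra +
  assumes flexible:
    "\<And>x y. bihom_associator \<mu> \<alpha> \<beta> (\<beta> (\<beta> x)) (\<alpha> (\<beta> y)) (\<alpha> (\<alpha> x)) = 0"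

locale admissible_bihom_poisson_algebra = bihom_algebra +
  assumes admissible:
    "\<And>x y z. bihom_associator \<mu> \<alpha> \<beta> (\<beta> x) (\<alpha> y) (\<alpha> (\<alpha> z)) =
       scale (1 / 3)
         (\<mu> (\<mu> (\<beta> x) (\<alpha> (\<beta> z))) (\<alpha> (\<alpha> y))
          - \<mu> (\<mu> (\<beta> (\<beta> z)) (\<alpha> x)) (\<alpha> (\<alpha> y))
          + \<mu> (\<mu> (\<beta> y) (\<alpha> (\<beta> z))) (\<alpha> (\<alpha> x))
          - \<mu> (\<mu> (\<beta> y) (\<alpha> x)) (\<beta> (\<alpha> (\<alpha> z))))"

end

theory Submission
  imports Defs
begin

text \<open>
  Replacing \<open>x\<close>, \<open>y\<close> by \<open>\<beta> x\<close>, \<open>\<beta> y\<close> in the admissibility identity gives the four terms on its right the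
  form \<open>\<mu> (\<mu> (\<beta>\<^sup>2 u) (\<alpha>\<beta> v)) (\<alpha>\<^sup>2\<beta> w)\<close>, because \<open>\<alpha>\<close> and \<open>\<beta>\<close> commute. They
  split into two pairs of opposite sign, and swapping \<open>x\<close> and \<open>z\<close> exchanges the two terms of each pair. So the associator
  is skew-symmetric in \<open>x\<close> and \<open>z\<close>, and it vanishes for \<open>z = x\<close>.
\<close>

lemma (in admissible_bihom_poisson_algebra) twisted_associator_eq:
  "bihom_associator \<mu> \<alpha> \<beta> (\<beta> (\<beta> x)) (\<alpha> (\<beta> y)) (\<alpha> (\<alpha> z)) =
     scale (1 / 3)
       (\<mu> (\<mu> (\<beta> (\<beta> x)) (\<alpha> (\<beta> z))) (\<alpha> (\<alpha> (\<beta> y)))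
        - \<mu> (\<mu> (\<beta> (\<beta> z)) (\<alpha> (\<beta> x))) (\<alpha> (\<alpha> (\<beta> y)))
        + \<mu> (\<mu> (\<beta> (\<beta> y)) (\<alpha> (\<beta> z))) (\<alpha> (\<alpha> (\<beta> x)))
        - \<mu> (\<mu> (\<beta> (\<beta> y)) (\<alpha> (\<beta> x))) (\<alpha> (\<alpha> (\<beta> z))))"
proof -
  have "\<beta> (\<alpha> u) = \<alpha> (\<beta> u)" for u
    using alpha_beta_commute by (metis comp_apply)
  then show ?thesis
    using admissible[of "\<beta> x" "\<beta> y" z] by simp
qed

theorem proposition3p15:
  fixes scale :: "'k::{alg_closed_field, field_char_0} \<Rightarrow> 'a::ab_group_add \<Rightarrow> 'a"
    and \<mu> :: "'a \<Rightarrow> 'a \<Rightarrow> 'a"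
    and \<alpha> \<beta> :: "'a \<Rightarrow> 'a"
  assumes "admissible_bihom_poisson_algebra scale \<mu> \<alpha> \<beta>"
  shows "bihom_flexible_algebra scale \<mu> \<alpha> \<beta> \<and>
    (\<forall>x y z. bihom_associator \<mu> \<alpha> \<beta> (\<beta> (\<beta> x)) (\<alpha> (\<beta> y)) (\<alpha> (\<alpha> z))
           + bihom_associator \<mu> \<alpha> \<beta> (\<beta> (\<beta> z)) (\<alpha> (\<beta> y)) (\<alpha> (\<alpha> x)) = 0)"
proof -
  interpret admissible_bihom_poisson_algebra scale \<mu> \<alpha> \<beta>
    by (rule assms)
  have "bihom_flexible_algebra scale \<mu> \<alpha> \<beta>"
    by unfold_locales (simp add: twisted_associator_eq)
  moreover have "bihom_associator \<mu> \<alpha> \<beta> (\<beta> (\<beta> x)) (\<alpha> (\<beta> y)) (\<alpha> (\<alpha> z))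
      + bihom_associator \<mu> \<alpha> \<beta> (\<beta> (\<beta> z)) (\<alpha> (\<beta> y)) (\<alpha> (\<alpha> x)) = 0" for x y z
    unfolding twisted_associator_eq scale_right_distrib[symmetric] by simp
  ultimately show ?thesis
    by blast
qed

end
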